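(* Let $k, q \ge 1$ be integers, let $\mathbf{a}, \mathbf{b} \in \mathbb{R}^k$ be fixed vectors, and let $P$ be a random real $q \times k$ matrix whose entries are independent and each distributed according to the normal distribution $\mathcal{N}(0, 1/q)$ (mean $0$, variance $1/q$). Then $$\mathbb{E}_P\left[P\mathbf{a} \cdot P\mathbf{b}\right] = \mathbf{a} \cdot \mathbf{b}$$ and $$\mathrm{Var}_P\left[P\mathbf{a} \cdot P\mathbf{b}\right] \le \frac{3\|\mathbf{a}\|^2 \|\mathbf{b}\|^2 - (\mathbf{a} \cdot \mathbf{b})^2}{q}.$$
   Context: Here $\cdot$ denotes the standard Euclidean scalar product (on $\mathbb{R}^q$ for $P\mathbf{a}\cdot P\mathbf{b}$ and on $\mathbb{R}^k$ for $\mathbf{a}\cdot\mathbf{b}$), $\|\cdot\|$ is the Euclidean norm, and $\mathbb{E}_P$, $\mathrm{Var}_P$ denote expectation and variance with respect to the random matrix $P$. *)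

theory Defs
  imports "HOL-Probability.Probability"
begin

end

theory Submission
  imports Defs
begin

text \<open>
  For a single row of \<open>P\<close>, every linear form in its entries is a centred Gaussian, so its
  second and fourth moments are explicit.  Polarization turns these into
  \<open>\<bbbE>[UV] = \<sigma>\<^sup>2 (a \<bullet> b)\<close> and
  \<open>\<bbbE>[(UV)\<^sup>2] = \<sigma>\<^sup>4 (\<parallel>a\<parallel>\<^sup>2 \<parallel>b\<parallel>\<^sup>2 + 2 (a \<bullet> b)\<^sup>2)\<close> for the two forms \<open>U\<close>, \<open>V\<close> given by \<open>a\<close>, \<open>b\<close>.  The rows contribute
  independent summands, so their variances add up to
  \<open>(\<parallel>a\<parallel>\<^sup>2 \<parallel>b\<parallel>\<^sup>2 + (a \<bullet> b)\<^sup>2) / q\<close>, and Cauchy-Schwarz gives the bound.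
\<close>

context prob_space
begin

text \<open>A combination of independent centred normals is again centred normal, and variances add.
  The factor \<open>fact (2 * k) / (2 ^ k * fact k)\<close> is the double factorial (2k-1)!!, the
  moment of order 2k of a standard normal.\<close>

lemma indep_normal_linear_combination_even_moment:
  fixes X :: "'i \<Rightarrow> 'a \<Rightarrow> real" and c :: "'i \<Rightarrow> real"
  assumes fin: "finite J" and indep: "indep_vars (\<lambda>_. borel) X J" and \<sigma>: "0 < \<sigma>"
    and normal: "\<And>j. j \<in> J \<Longrightarrow> distributed M lborel (X j) (normal_density 0 \<sigma>)"
  shows "has_bochner_integral M (\<lambda>\<omega>. (\<Sum>j\<in>J. c j * X j \<omega>) ^ (2 * k))
    (fact (2 * k) / (2 ^ k * fact k) * (\<sigma>\<^sup>2 * (\<Sum>j\<in>J. (c j)\<^sup>2)) ^ k)"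
proof -
  \<comment> \<open>Zero coefficients are dropped because \<open>c j * X j\<close> would then be
    constant and have no normal density.\<close>
  define K where "K = {j \<in> J. c j \<noteq> 0}"
  have fK: "finite K" and KJ: "K \<subseteq> J" using fin by (auto simp: K_def)
  have sum1: "(\<Sum>j\<in>J. c j * X j \<omega>) = (\<Sum>j\<in>K. c j * X j \<omega>)" for \<omega>
    using fin by (intro sum.mono_neutral_right) (auto simp: K_def)
  have sum2: "(\<Sum>j\<in>J. (c j)\<^sup>2) = (\<Sum>j\<in>K. (c j)\<^sup>2)"
    using fin by (intro sum.mono_neutral_right) (auto simp: K_def)
  show ?thesis
  proof (cases "K = {}")
    case True
    \<comment> \<open>The form vanishes identically here; only \<open>k = 0\<close> gives a nonzero
      integrand, since \<open>0 ^ 0 = 1\<close>, and then the total mass is needed.\<close>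
    have "has_bochner_integral M (\<lambda>_. 1::real) 1"
      by (simp add: has_bochner_integral_iff prob_space)
    with True show ?thesis
      unfolding sum1 sum2 by (cases k) auto
  next
    case False
    define s where "s = sqrt (\<Sum>j\<in>K. (\<bar>c j\<bar> * \<sigma>)\<^sup>2)"
    have s2: "s\<^sup>2 = \<sigma>\<^sup>2 * (\<Sum>j\<in>K. (c j)\<^sup>2)"
      by (simp add: s_def sum_nonneg power_mult_distrib mult.commute sum_distrib_left)
    have indK: "indep_vars (\<lambda>_. borel) (\<lambda>j \<omega>. c j * X j \<omega>) K"
      using indep_vars_subset[OF indep KJ] by (rule indep_vars_compose2) measurable
    have normK: "distributed M lborel (\<lambda>\<omega>. c j * X j \<omega>) (normal_density 0 (\<bar>c j\<bar> * \<sigma>))"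
      if "j \<in> K" for j
      using normal_density_affine[OF normal \<sigma>, of j "c j" 0] that by (auto simp: K_def)
    have D: "distributed M lborel (\<lambda>\<omega>. \<Sum>j\<in>K. c j * X j \<omega>) (normal_density 0 s)"
      using sum_indep_normal[OF fK False indK _ normK] \<sigma> by (auto simp: K_def s_def)
    have "0 < s"
      unfolding s_def using False \<sigma> fK by (auto simp: K_def intro!: sum_pos)
    then have hb: "has_bochner_integral lborel (\<lambda>x. normal_density 0 s x * x ^ (2 * k))
        (fact (2 * k) / ((2 / s\<^sup>2) ^ k * fact k))"
      using normal_moment_even[of s 0 k] by simp
    have "(fact (2 * k) / ((2 / s\<^sup>2) ^ k * fact k) :: real) = fact (2 * k) / (2 ^ k * fact k) * (s\<^sup>2) ^ k"
      by (simp add: power_divide)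
    with hb show ?thesis
      using distributed_integrable[OF D, of "\<lambda>x. x ^ (2 * k)"]
        distributed_integral[OF D, of "\<lambda>x. x ^ (2 * k)"]
      unfolding sum1 sum2 has_bochner_integral_iff s2[symmetric] by simp
  qed
qed

lemma indep_normal_linear_forms_product_moments:
  fixes X :: "'k::finite \<Rightarrow> 'a \<Rightarrow> real" and a b :: "real ^ 'k"
  assumes indep: "indep_vars (\<lambda>_. borel) X UNIV" and \<sigma>: "0 < \<sigma>"
    and normal: "\<And>j. distributed M lborel (X j) (normal_density 0 \<sigma>)"
  defines "L \<equiv> \<lambda>c \<omega>. \<Sum>j\<in>UNIV. c $ j * X j \<omega>"
  shows "has_bochner_integral M (\<lambda>\<omega>. L a \<omega> * L b \<omega>) (\<sigma>\<^sup>2 * (a \<bullet> b))"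
    and "has_bochner_integral M (\<lambda>\<omega>. (L a \<omega> * L b \<omega>)\<^sup>2)
      (\<sigma> ^ 4 * ((norm a)\<^sup>2 * (norm b)\<^sup>2 + 2 * (a \<bullet> b)\<^sup>2))"
proof -
  have nrm: "(\<Sum>j\<in>UNIV. (c $ j)\<^sup>2) = c \<bullet> c" for c :: "real ^ 'k"
    by (simp add: inner_vec_def power2_eq_square)
  note mom = indep_normal_linear_combination_even_moment[OF finite indep \<sigma> normal]
  \<comment> \<open>The double factorials for orders 2 and 4 are 1 and 3.\<close>
  have m2: "has_bochner_integral M (\<lambda>\<omega>. (L c \<omega>)\<^sup>2) (\<sigma>\<^sup>2 * (c \<bullet> c))" for c
    using mom[of "\<lambda>j. c $ j" 1] by (simp add: L_def nrm)
  have m4: "has_bochner_integral M (\<lambda>\<omega>. (L c \<omega>) ^ 4) (3 * \<sigma> ^ 4 * (c \<bullet> c)\<^sup>2)" for c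
    using mom[of "\<lambda>j. c $ j" 2]
    by (simp add: L_def nrm fact_numeral power_mult_distrib mult.assoc flip: power_mult)
  have Ladd: "L (a + b) \<omega> = L a \<omega> + L b \<omega>" and Ldiff: "L (a - b) \<omega> = L a \<omega> - L b \<omega>" for \<omega>
    by (simp_all add: L_def algebra_simps sum.distrib sum_subtractf)
  \<comment> \<open>Polarization: 4uv = (u+v)^2 - (u-v)^2, with \<open>L\<close> linear in the
    coefficient vector.\<close>
  have "has_bochner_integral M (\<lambda>\<omega>. ((L (a + b) \<omega>)\<^sup>2 - (L (a - b) \<omega>)\<^sup>2) / 4)
      ((\<sigma>\<^sup>2 * ((a + b) \<bullet> (a + b)) - \<sigma>\<^sup>2 * ((a - b) \<bullet> (a - b))) / 4)"
    by (intro has_bochner_integral_divide has_bochner_integral_diff m2)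
  also have "(\<lambda>\<omega>. ((L (a + b) \<omega>)\<^sup>2 - (L (a - b) \<omega>)\<^sup>2) / 4) = (\<lambda>\<omega>. L a \<omega> * L b \<omega>)"
    by (simp add: Ladd Ldiff power2_eq_square algebra_simps)
  also have "(\<sigma>\<^sup>2 * ((a + b) \<bullet> (a + b)) - \<sigma>\<^sup>2 * ((a - b) \<bullet> (a - b))) / 4 = \<sigma>\<^sup>2 * (a \<bullet> b)"
    by (simp add: inner_simps inner_commute algebra_simps)
  finally show "has_bochner_integral M (\<lambda>\<omega>. L a \<omega> * L b \<omega>) (\<sigma>\<^sup>2 * (a \<bullet> b))" .
  \<comment> \<open>The quartic analogue: 12 u^2 v^2 = (u+v)^4 + (u-v)^4 - 2u^4 - 2v^4.\<close>
  have "has_bochner_integral M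
      (\<lambda>\<omega>. (L (a + b) \<omega> ^ 4 + L (a - b) \<omega> ^ 4 - 2 * L a \<omega> ^ 4 - 2 * L b \<omega> ^ 4) / 12)
      ((3 * \<sigma> ^ 4 * ((a + b) \<bullet> (a + b))\<^sup>2 + 3 * \<sigma> ^ 4 * ((a - b) \<bullet> (a - b))\<^sup>2
        - 2 * (3 * \<sigma> ^ 4 * (a \<bullet> a)\<^sup>2) - 2 * (3 * \<sigma> ^ 4 * (b \<bullet> b)\<^sup>2)) / 12)"
    by (intro has_bochner_integral_divide has_bochner_integral_diff has_bochner_integral_add
        has_bochner_integral_mult_right m4)
  also have "(\<lambda>\<omega>. (L (a + b) \<omega> ^ 4 + L (a - b) \<omega> ^ 4 - 2 * L a \<omega> ^ 4 - 2 * L b \<omega> ^ 4) / 12)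
      = (\<lambda>\<omega>. (L a \<omega> * L b \<omega>)\<^sup>2)"
    by (simp add: Ladd Ldiff power2_eq_square power4_eq_xxxx algebra_simps)
  also have "(3 * \<sigma> ^ 4 * ((a + b) \<bullet> (a + b))\<^sup>2 + 3 * \<sigma> ^ 4 * ((a - b) \<bullet> (a - b))\<^sup>2
        - 2 * (3 * \<sigma> ^ 4 * (a \<bullet> a)\<^sup>2) - 2 * (3 * \<sigma> ^ 4 * (b \<bullet> b)\<^sup>2)) / 12
      = \<sigma> ^ 4 * ((norm a)\<^sup>2 * (norm b)\<^sup>2 + 2 * (a \<bullet> b)\<^sup>2)"
    unfolding power2_norm_eq_inner
    by (simp add: inner_simps inner_commute[of b a] power2_eq_square algebra_simps)
  finally show "has_bochner_integral M (\<lambda>\<omega>. (L a \<omega> * L b \<omega>)\<^sup>2)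
      (\<sigma> ^ 4 * ((norm a)\<^sup>2 * (norm b)\<^sup>2 + 2 * (a \<bullet> b)\<^sup>2))" .
qed

text \<open>Expanding the square of the sum leaves only expectations of pairwise products, and
  independence factors those off the diagonal.\<close>

lemma
  fixes X :: "'i \<Rightarrow> 'a \<Rightarrow> real"
  assumes fin: "finite I" and indep: "indep_vars (\<lambda>_. borel) X I"
    and int: "\<And>i. i \<in> I \<Longrightarrow> integrable M (X i)"
    and int2: "\<And>i. i \<in> I \<Longrightarrow> integrable M (\<lambda>\<omega>. (X i \<omega>)\<^sup>2)"
  shows integrable_power2_sum_indep: "integrable M (\<lambda>\<omega>. (\<Sum>i\<in>I. X i \<omega>)\<^sup>2)"
    and variance_sum_indep: "variance (\<lambda>\<omega>. \<Sum>i\<in>I. X i \<omega>) = (\<Sum>i\<in>I. variance (X i))"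
proof -
  \<comment> \<open>Writing the diagonal as a product of means plus a variance makes the double sum
    collapse to the squared mean of the sum plus the sum of variances.\<close>
  have prod: "integrable M (\<lambda>\<omega>. X i \<omega> * X j \<omega>) \<and>
      expectation (\<lambda>\<omega>. X i \<omega> * X j \<omega>) =
        expectation (X i) * expectation (X j) + (if i = j then variance (X i) else 0)"
    if "i \<in> I" "j \<in> I" for i j
  proof (cases "i = j")
    case True
    with that int int2 variance_eq[of "X i"] show ?thesis
      by (simp add: power2_eq_square)
  next
    case False
    have ind: "indep_vars (\<lambda>_. borel) X {i, j}"
      using indep_vars_subset[OF indep] that by auto
    show ?thesis
      using indep_vars_lebesgue_integral[OF _ ind] indep_vars_integrable[OF _ ind] int that False
      by auto
  qed
  have sq: "(\<Sum>i\<in>I. X i \<omega>)\<^sup>2 = (\<Sum>i\<in>I. \<Sum>j\<in>I. X i \<omega> * X j \<omega>)" for \<omega>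
    by (simp add: power2_eq_square sum_product)
  show int_sq: "integrable M (\<lambda>\<omega>. (\<Sum>i\<in>I. X i \<omega>)\<^sup>2)"
    unfolding sq using prod by (intro Bochner_Integration.integrable_sum) auto
  have "expectation (\<lambda>\<omega>. (\<Sum>i\<in>I. X i \<omega>)\<^sup>2) = (\<Sum>i\<in>I. \<Sum>j\<in>I. expectation (\<lambda>\<omega>. X i \<omega> * X j \<omega>))"
    unfolding sq using prod by (simp add: Bochner_Integration.integral_sum)
  also have "\<dots> = (\<Sum>i\<in>I. expectation (X i))\<^sup>2 + (\<Sum>i\<in>I. variance (X i))"
    using prod fin by (simp add: sum.distrib power2_eq_square sum_product sum.delta)
  finally show "variance (\<lambda>\<omega>. \<Sum>i\<in>I. X i \<omega>) = (\<Sum>i\<in>I. variance (X i))"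
    using int by (subst variance_eq) (auto intro: int_sq)
qed

end

text \<open>Integrability is stated explicitly because the Bochner integral of a non-integrable
  function is 0 by convention. \<open>normal_density\<close> takes the standard deviation, hence the
  square root of 1/q.\<close>

theorem mainTheorem1:
  fixes M :: "'w measure"
    and P :: "'w \<Rightarrow> real ^ 'k ^ 'q"
    and a b :: "real ^ 'k"
  assumes "prob_space M"
    and indep: "prob_space.indep_vars M (\<lambda>_. borel)
           (\<lambda>(i, j) \<omega>. P \<omega> $ i $ j) (UNIV :: ('q \<times> 'k) set)"
    and normal: "\<And>i j. distributed M lborel (\<lambda>\<omega>. P \<omega> $ i $ j)
           (\<lambda>x. ennreal (normal_density 0 (sqrt (1 / real CARD('q))) x))"
  shows "integrable M (\<lambda>\<omega>. (P \<omega> *v a) \<bullet> (P \<omega> *v b))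
    \<and> integrable M (\<lambda>\<omega>. ((P \<omega> *v a) \<bullet> (P \<omega> *v b))\<^sup>2)
    \<and> prob_space.expectation M (\<lambda>\<omega>. (P \<omega> *v a) \<bullet> (P \<omega> *v b)) = a \<bullet> b
    \<and> prob_space.variance M (\<lambda>\<omega>. (P \<omega> *v a) \<bullet> (P \<omega> *v b))
           \<le> (3 * (norm a)\<^sup>2 * (norm b)\<^sup>2 - (a \<bullet> b)\<^sup>2) / real CARD('q)"
proof -
  interpret prob_space M by fact
  define \<sigma> where "\<sigma> = sqrt (1 / real CARD('q))"
  have \<sigma>: "0 < \<sigma>" and \<sigma>2: "\<sigma>\<^sup>2 = 1 / real CARD('q)"
    by (simp_all add: \<sigma>_def)
  have \<sigma>4: "\<sigma> ^ 4 = 1 / (real CARD('q))\<^sup>2"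
    using \<sigma>2 by (metis power_mult num_double numeral_times_numeral power_one_over)
  define L :: "'q \<Rightarrow> real ^ 'k \<Rightarrow> 'w \<Rightarrow> real"
    where "L = (\<lambda>i c \<omega>. \<Sum>j\<in>UNIV. c $ j * P \<omega> $ i $ j)"
  define X where "X i \<omega> = L i a \<omega> * L i b \<omega>" for i \<omega>
  \<comment> \<open>Grouping the entries into disjoint blocks makes whole rows independent; each
    \<open>X i\<close> is a measurable function of row \<open>i\<close> alone.\<close>
  have rows: "indep_vars (\<lambda>i. PiM ({i} \<times> UNIV) (\<lambda>_. borel))
      (\<lambda>i \<omega>. \<lambda>p\<in>{i} \<times> UNIV. (\<lambda>(i, j) \<omega>. P \<omega> $ i $ j) p \<omega>) (UNIV :: 'q set)"
    by (rule indep_vars_restrict[OF indep]) (auto simp: disjoint_family_on_def)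
  have indX: "indep_vars (\<lambda>_. borel) X UNIV"
  proof -
    have "indep_vars (\<lambda>_. borel) (\<lambda>i \<omega>.
        (\<lambda>f. (\<Sum>j\<in>UNIV. a $ j * f (i, j)) * (\<Sum>j\<in>UNIV. b $ j * f (i, j)))
          (\<lambda>p\<in>{i} \<times> UNIV. (\<lambda>(i, j) \<omega>. P \<omega> $ i $ j) p \<omega>)) (UNIV :: 'q set)"
      by (rule indep_vars_compose2[OF rows]) measurable
    then show ?thesis
      by (simp add: X_def[abs_def] L_def)
  qed
  \<comment> \<open>Singleton blocks serve to reindex: independence over pairs becomes independence
    over \<open>j\<close> within the fixed row \<open>i\<close>.\<close>
  have indrow: "indep_vars (\<lambda>_. borel) (\<lambda>j \<omega>. P \<omega> $ i $ j) UNIV" for i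
  proof -
    have "indep_vars (\<lambda>j. PiM {(i, j)} (\<lambda>_. borel))
        (\<lambda>j \<omega>. \<lambda>p\<in>{(i, j)}. (\<lambda>(i, j) \<omega>. P \<omega> $ i $ j) p \<omega>) UNIV"
      by (rule indep_vars_restrict[OF indep]) (auto simp: disjoint_family_on_def)
    then have "indep_vars (\<lambda>_. borel) (\<lambda>j \<omega>. (\<lambda>f. f (i, j))
        (\<lambda>p\<in>{(i, j)}. (\<lambda>(i, j) \<omega>. P \<omega> $ i $ j) p \<omega>)) UNIV"
      by (rule indep_vars_compose2) measurable
    then show ?thesis by simp
  qed
  note mom = indep_normal_linear_forms_product_moments[OF indrow \<sigma> normal[folded \<sigma>_def],
      where a = a and b = b, folded L_def]
  have mom1: "has_bochner_integral M (X i) ((a \<bullet> b) / CARD('q))"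
    and mom2: "has_bochner_integral M (\<lambda>\<omega>. (X i \<omega>)\<^sup>2)
      (((norm a)\<^sup>2 * (norm b)\<^sup>2 + 2 * (a \<bullet> b)\<^sup>2) / (CARD('q))\<^sup>2)" for i
    using mom[of i] by (simp_all add: X_def[abs_def] L_def \<sigma>2 \<sigma>4)
  have int: "integrable M (X i)" "integrable M (\<lambda>\<omega>. (X i \<omega>)\<^sup>2)" for i
    using mom1 mom2 by (auto simp: has_bochner_integral_iff)
  \<comment> \<open>Subtracting the squared mean removes one of the two copies of
    \<open>(a \<bullet> b)\<^sup>2\<close> in the second moment.\<close>
  have var: "variance (X i) = ((norm a)\<^sup>2 * (norm b)\<^sup>2 + (a \<bullet> b)\<^sup>2) / (CARD('q))\<^sup>2" for i
    using mom1[of i] mom2[of i]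
    by (subst variance_eq) (auto simp: has_bochner_integral_iff power_divide simp flip: diff_divide_distrib)
  have eq: "(P \<omega> *v a) \<bullet> (P \<omega> *v b) = (\<Sum>i\<in>UNIV. X i \<omega>)" for \<omega>
    by (simp add: inner_vec_def matrix_vector_mult_def X_def L_def mult.commute)
  have "(a \<bullet> b)\<^sup>2 \<le> (norm a)\<^sup>2 * (norm b)\<^sup>2"
    using Cauchy_Schwarz_ineq[of a b] by (simp add: power2_norm_eq_inner)
  \<comment> \<open>The numerators differ by twice the Cauchy-Schwarz gap.\<close>
  then have "((norm a)\<^sup>2 * (norm b)\<^sup>2 + (a \<bullet> b)\<^sup>2) / CARD('q)
      \<le> (3 * (norm a)\<^sup>2 * (norm b)\<^sup>2 - (a \<bullet> b)\<^sup>2) / CARD('q)"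
    by (intro divide_right_mono) auto
  \<comment> \<open>There are q equal variances, each carrying 1/q^2, so one factor 1/q
    survives.\<close>
  moreover have "variance (\<lambda>\<omega>. \<Sum>i\<in>UNIV. X i \<omega>) = ((norm a)\<^sup>2 * (norm b)\<^sup>2 + (a \<bullet> b)\<^sup>2) / CARD('q)"
    unfolding variance_sum_indep[OF finite indX int] var by (simp add: power2_eq_square)
  moreover have "expectation (\<lambda>\<omega>. \<Sum>i\<in>UNIV. X i \<omega>) = a \<bullet> b"
    using mom1 by (simp add: has_bochner_integral_iff)
  ultimately show ?thesis
    unfolding eq using integrable_power2_sum_indep[OF finite indX int] int by simp
qed

end
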